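(* Let $d \geq 1$ and let $\mu$ be any non-negative normalized Borel measure on $[0,1]^d$. Then there exists an infinite sequence $(x_n)_{n \geq 1}$ of points from $[0,1]^d$ such that $$ D_N^*(x_1, \dots, x_N; \mu) \leq 133 \sqrt{d+1}\, \frac{(4 + 2 \log_2 N)^{(3d+4)/2}}{N} \qquad \textrm{for all } N \geq 1. $$
   Context: For points $x_1,\dots,x_N\in[0,1]^d$ and a non-negative normalized Borel measure $\mu$ on $[0,1]^d$, the star-discrepancy with respect to $\mu$ is $$D_N^*(x_1, \dots, x_N;\mu) = \sup_{A} \left| \frac{1}{N} \sum_{n=1}^N \mathbf{1}_A (x_n) - \mu(A) \right|,$$ where the supremum is over all axis-parallel boxes $A=\prod_{s=1}^d[0,a_s]\subset[0,1]^d$ having one vertex at the origin. $\log_2$ denotes the binary logarithm. *)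

theory Defs
  imports "HOL-Probability.Probability"
begin

definition unit_cube :: "(real ^ 'd::finite) set" where
  "unit_cube = cbox 0 1"

(* The points are x 1, ..., x N. For a probability measure on the unit cube the supremum
   is over a nonempty set of reals bounded by 1, so it is a genuine supremum. *)
definition star_discrepancy ::
    "(real ^ 'd::finite) measure \<Rightarrow> (nat \<Rightarrow> real ^ 'd) \<Rightarrow> nat \<Rightarrow> real" where
  "star_discrepancy \<mu> x N =
     (SUP A \<in> {cbox 0 a | a. a \<in> unit_cube}.
        \<bar>(1 / real N) * (\<Sum>n = 1..N. indicator A (x n)) - measure \<mu> A\<bar>)"

end

theory Submission
  imports Defs "HOL-Library.Discrete_Functions"
begin

text \<open>
  The sequence is a concatenation of blocks of length \<open>n = 2 ^ k\<close>, and each block is balanced on all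
  its prefixes. Within a block, the quantiles of the marginals of \<open>\<mu>\<close> cut every coordinate axis into
  at most \<open>2 * n + 1\<close> pieces, each a single point or of mass at most \<open>1 / n\<close>, so that only the
  boxes \<open>{c. \<forall>s. c s < h s}\<close> of the resulting grid of cells matter. Such a box is a disjoint union of
  at most \<open>(k + 3) ^ d\<close> dyadic boxes, and a cell lies in exactly \<open>(k + 3) ^ d\<close> dyadic boxes.

  The cells of a block are chosen one after the other by a self-balancing random walk in the spirit
  of Alweiss, Liu and Sawhney. Let \<open>u c\<close> be the centred vector of dyadic box indicators of the cell
  \<open>c\<close>, and \<open>w\<close> the sum of the vectors chosen so far. The next cell is \<open>c\<close> with probability
  \<open>p c * (1 - \<langle>u c, w\<rangle> / b)\<close>, where \<open>p c\<close> is the \<open>\<mu>\<close>-mass of \<open>c\<close>. This drift towards the origin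
  keeps \<open>w\<close> subgaussian with variance of order \<open>b\<close>, independently of the number of steps, and a
  union bound over all times and all dyadic boxes yields a choice with small discrepancy.
\<close>

section \<open>The self-balancing walk\<close>

text \<open>For negative \<open>a\<close> the Taylor bound that is available runs the wrong way, so
  it is applied to \<open>exp (- a)\<close> and multiplied by the right-hand side: with
  \<open>t = - a\<close> the product of the two quadratics is
  \<open>1 + t\<^sup>2 * ((1 + t + t\<^sup>2) / 2)\<close>, hence at least 1.\<close>

lemma exp_le_quadratic:
  fixes a :: real
  assumes "\<bar>a\<bar> \<le> 1"
  shows "exp a \<le> 1 + a + a\<^sup>2"
proof (cases "a \<ge> 0")
  case True
  then show ?thesis using exp_bound[of a] assms by simp
next
  case False
  have "exp (- a) * (1 + a + a\<^sup>2) \<ge> 1"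
  proof -
    define t where "t = - a"
    have t: "0 \<le> t" "t \<le> 1" using False assms by (auto simp: t_def)
    have "1 + t + t\<^sup>2 / 2 \<le> exp t" using exp_lower_Taylor_quadratic[of t] t by simp
    moreover have "0 \<le> 1 - t + t\<^sup>2" using t by (simp add: add_nonneg_nonneg)
    ultimately have "(1 + t + t\<^sup>2 / 2) * (1 - t + t\<^sup>2) \<le> exp t * (1 - t + t\<^sup>2)"
      by (rule mult_right_mono)
    moreover have "(1 + t + t\<^sup>2 / 2) * (1 - t + t\<^sup>2) = 1 + t\<^sup>2 * ((1 + t + t\<^sup>2) / 2)"
      by (simp add: field_simps power2_eq_square)
    moreover have "t\<^sup>2 * ((1 + t + t\<^sup>2) / 2) \<ge> 0"
      using t by simp
    ultimately show ?thesis by (simp add: t_def)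
  qed
  then show ?thesis by (simp add: exp_minus field_simps)
qed

text \<open>Here \<open>r\<close> bounds the squared length of a step, and \<open>X\<close> sets the
  failure probability: every single bad event will have mass at most
  \<open>2 * exp (- X)\<close>.\<close>

locale tilted_walk =
  fixes C :: "'c set" and p :: "'c \<Rightarrow> real" and I :: "'i set" and u :: "'c \<Rightarrow> 'i \<Rightarrow> real"
    and r X :: real
  assumes fin_C: "finite C" and fin_I: "finite I"
    and p_nonneg: "c \<in> C \<Longrightarrow> 0 \<le> p c" and p_sum: "sum p C = 1"
    and u_mean: "i \<in> I \<Longrightarrow> (\<Sum>c\<in>C. p c * u c i) = 0"
    and u_norm: "c \<in> C \<Longrightarrow> (\<Sum>i\<in>I. (u c i)\<^sup>2) \<le> r"
    and r_pos: "0 < r" and X_ge: "1 \<le> X"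
begin

definition ip :: "('i \<Rightarrow> real) \<Rightarrow> ('i \<Rightarrow> real) \<Rightarrow> real" where
  "ip f g = (\<Sum>i\<in>I. f i * g i)"

text \<open>The drift is inversely proportional to \<open>tilt\<close>. The factor 8 makes the tail
  exponents in \<open>Ex_bad\<close> come out as exactly \<open>- X\<close>.\<close>

definition tilt :: real where "tilt = 8 * r * X"

primrec pos :: "'c list \<Rightarrow> 'i \<Rightarrow> real" where
  "pos [] = (\<lambda>i. 0)"
| "pos (c # cs) = (\<lambda>i. pos cs i + u c i)"

text \<open>The first condition keeps the step weights in [0, 2]; the second is the bound that the
  walk is run for.\<close>

definition good :: "'c list \<Rightarrow> bool" where
  "good cs \<longleftrightarrow> (\<forall>c\<in>C. \<bar>ip (u c) (pos cs)\<bar> \<le> tilt) \<and> (\<forall>i\<in>I. \<bar>pos cs i\<bar> \<le> 8 * sqrt r * X)"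

text \<open>Unnormalised expectation over the walk whose next step is \<open>c\<close> with probability
  \<open>p c * (1 - \<langle>u c, pos\<rangle> / tilt)\<close>, killed once it is no longer \<open>good\<close>. The head of the list is the
  most recent step.\<close>

primrec Ex :: "nat \<Rightarrow> ('c list \<Rightarrow> real) \<Rightarrow> real" where
  "Ex 0 g = g []"
| "Ex (Suc n) g =
     Ex n (\<lambda>cs. if good cs then \<Sum>c\<in>C. p c * (1 - ip (u c) (pos cs) / tilt) * g (c # cs) else 0)"

lemma tilt_pos: "0 < tilt"
  using r_pos X_ge by (simp add: tilt_def)

lemma r_le_tilt: "r \<le> tilt"
  using r_pos X_ge mult_left_mono[of 1 "8 * X" r] by (simp add: tilt_def)

lemma ip_commute: "ip f g = ip g f"
  by (simp add: ip_def mult.commute)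

lemma ip_add_right: "ip f (\<lambda>i. g i + h i) = ip f g + ip f h"
  by (simp add: ip_def algebra_simps sum.distrib)

lemma ip_scale_left: "ip (\<lambda>i. a * f i) g = a * ip f g"
  by (simp add: ip_def sum_distrib_left mult.assoc)

lemma ip_scale_right: "ip f (\<lambda>i. a * g i) = a * ip f g"
  by (simp add: ip_def sum_distrib_left algebra_simps)

lemma ip_diff_left: "ip (\<lambda>i. f i - g i) h = ip f h - ip g h"
  by (simp add: ip_def algebra_simps sum_subtractf)

lemma ip_diff_right: "ip h (\<lambda>i. f i - g i) = ip h f - ip h g"
  by (simp add: ip_def algebra_simps sum_subtractf)

lemma ip_sum_left: "ip (\<lambda>i. \<Sum>c\<in>A. f c i) g = (\<Sum>c\<in>A. ip (f c) g)"
  by (simp add: ip_def sum_distrib_right sum.swap[of _ A])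

lemma ip_nonneg: "0 \<le> ip f f"
  by (simp add: ip_def sum_nonneg)

lemma ip_Cauchy_Schwarz: "(ip f g)\<^sup>2 \<le> ip f f * ip g g"
  using Cauchy_Schwarz_ineq_sum[of f g I] by (simp add: ip_def power2_eq_square)

lemma ip_u: "c \<in> C \<Longrightarrow> ip (u c) (u c) \<le> r"
  using u_norm by (simp add: ip_def power2_eq_square)

lemma ip_u_mean: "(\<Sum>c\<in>C. p c * ip (u c) f) = 0"
proof -
  have "(\<Sum>c\<in>C. p c * ip (u c) f) = ip (\<lambda>i. \<Sum>c\<in>C. p c * u c i) f"
    by (simp add: ip_sum_left ip_scale_left)
  also have "\<dots> = 0" unfolding ip_def using u_mean by (intro sum.neutral) auto
  finally show ?thesis .
qed

lemma tilt_weight_nonneg: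
  assumes "good cs" "c \<in> C"
  shows "0 \<le> 1 - ip (u c) (pos cs) / tilt" "1 - ip (u c) (pos cs) / tilt \<le> 2"
proof -
  have "\<bar>ip (u c) (pos cs)\<bar> \<le> tilt" using assms by (auto simp: good_def)
  then show "0 \<le> 1 - ip (u c) (pos cs) / tilt" "1 - ip (u c) (pos cs) / tilt \<le> 2"
    using tilt_pos by (auto simp: field_simps abs_le_iff)
qed

section \<open>Monotonicity and linearity of the killed expectation\<close>

lemma Ex_mono: "(\<And>cs. g cs \<le> h cs) \<Longrightarrow> Ex n g \<le> Ex n h"
proof (induction n arbitrary: g h)
  case (Suc n)
  show ?case unfolding Ex.simps
    by (rule Suc.IH) (auto intro!: sum_mono mult_left_mono mult_nonneg_nonneg p_nonneg
        tilt_weight_nonneg(1) Suc.prems simp del: diff_ge_0_iff_ge)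
qed simp

lemma Ex_scale: "Ex n (\<lambda>cs. a * g cs) = a * Ex n g"
proof (induction n arbitrary: g)
  case (Suc n)
  have "Ex (Suc n) (\<lambda>cs. a * g cs) = Ex n (\<lambda>cs. a * (if good cs then
      \<Sum>c\<in>C. p c * (1 - ip (u c) (pos cs) / tilt) * g (c # cs) else 0))"
    unfolding Ex.simps by (intro arg_cong[of _ _ "Ex n"] ext) (simp add: sum_distrib_left mult_ac)
  then show ?case by (simp only: Suc.IH Ex.simps)
qed simp

lemma Ex_add: "Ex n (\<lambda>cs. g cs + h cs) = Ex n g + Ex n h"
proof (induction n arbitrary: g h)
  case (Suc n)
  show ?case unfolding Ex.simps Suc.IH[symmetric]
    by (intro arg_cong[of _ _ "Ex n"] ext) (simp add: distrib_left sum.distrib)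
qed simp

lemma Ex_zero: "Ex n (\<lambda>cs. 0) = 0"
  using Ex_scale[of n 0 "\<lambda>cs. 0"] by simp

lemma Ex_sum: "finite A \<Longrightarrow> Ex n (\<lambda>cs. \<Sum>a\<in>A. g a cs) = (\<Sum>a\<in>A. Ex n (g a))"
  by (induction A rule: finite_induct) (simp_all add: Ex_add Ex_zero)

text \<open>The tilt turns the moment generating function at \<open>\<theta>\<close> after the step into the one at the
  shorter vector \<open>\<theta>'\<close> before the step, and the gain in length pays for the second moment.\<close>

lemma Ex_exp_le:
  "r * ip \<theta> \<theta> \<le> 1 \<Longrightarrow> Ex n (\<lambda>cs. exp (ip \<theta> (pos cs))) \<le> exp (2 * tilt * ip \<theta> \<theta>)"
proof (induction n arbitrary: \<theta>)
  case 0
  then show ?case using tilt_pos ip_nonneg[of \<theta>] by (simp add: ip_def)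
next
  case (Suc n)
  define a where "a c = ip (u c) \<theta>" for c
  \<comment> \<open>\<open>m\<close> is the covariance operator of the step vectors under
    \<open>p\<close> applied to \<open>\<theta>\<close>, and \<open>Q\<close> is its quadratic form
    at \<open>\<theta>\<close>. The drift changes the mean exponent by
    \<open>- ip m (pos cs) / tilt\<close>, which amounts to replacing \<open>\<theta>\<close> by
    \<open>\<theta>'\<close>.\<close>
  define Q where "Q = (\<Sum>c\<in>C. p c * (a c)\<^sup>2)"
  define m where "m i = (\<Sum>c\<in>C. p c * a c * u c i)" for i
  define \<theta>' where "\<theta>' i = \<theta> i - (1 / tilt) * m i" for i
  have a_bound: "\<bar>a c\<bar> \<le> 1" if "c \<in> C" for c
  proof -
    have "(a c)\<^sup>2 \<le> ip (u c) (u c) * ip \<theta> \<theta>" unfolding a_def by (rule ip_Cauchy_Schwarz)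
    also have "\<dots> \<le> r * ip \<theta> \<theta>" using ip_u[OF that] ip_nonneg by (intro mult_right_mono)
    finally have "(a c)\<^sup>2 \<le> 1" using Suc.prems by linarith
    then show ?thesis by (simp add: abs_square_le_1)
  qed
  have Q_nonneg: "0 \<le> Q" unfolding Q_def by (intro sum_nonneg) (simp add: p_nonneg)
  have ip_m: "ip m f = (\<Sum>c\<in>C. p c * a c * ip (u c) f)" for f
    unfolding m_def by (simp add: ip_sum_left ip_scale_left)
  have m\<theta>: "ip m \<theta> = Q"
    unfolding ip_m Q_def a_def[symmetric] by (simp add: power2_eq_square mult.assoc)
  \<comment> \<open>The covariance operator has norm at most \<open>r\<close>: Cauchy-Schwarz with
    weights \<open>sqrt (p c)\<close> bounds \<open>(ip m m)\<^sup>2\<close> by \<open>Q\<close>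
    times the second moment of \<open>ip (u c) m\<close>, which is at most
    \<open>r * ip m m\<close>; one factor cancels.\<close>
  have mm: "ip m m \<le> r * Q"
  proof -
    have "(ip m m)\<^sup>2 = (\<Sum>c\<in>C. (sqrt (p c) * a c) * (sqrt (p c) * ip (u c) m))\<^sup>2"
    proof -
      have "p c * a c * ip (u c) m = (sqrt (p c) * a c) * (sqrt (p c) * ip (u c) m)" if "c \<in> C" for c
      proof -
        have "p c = sqrt (p c) * sqrt (p c)" using p_nonneg[OF that] by simp
        then show ?thesis by (metis mult.assoc mult.left_commute)
      qed
      then show ?thesis unfolding ip_m[of m] by (metis (no_types, lifting) sum.cong)
    qed
    also have "\<dots> \<le> (\<Sum>c\<in>C. (sqrt (p c) * a c)\<^sup>2) * (\<Sum>c\<in>C. (sqrt (p c) * ip (u c) m)\<^sup>2)"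
      by (rule Cauchy_Schwarz_ineq_sum)
    also have "\<dots> = Q * (\<Sum>c\<in>C. p c * (ip (u c) m)\<^sup>2)"
      unfolding Q_def by (simp add: power_mult_distrib p_nonneg)
    also have "\<dots> \<le> Q * (\<Sum>c\<in>C. p c * (r * ip m m))"
    proof (intro mult_left_mono sum_mono Q_nonneg p_nonneg)
      fix c assume "c \<in> C"
      have "(ip (u c) m)\<^sup>2 \<le> ip (u c) (u c) * ip m m" by (rule ip_Cauchy_Schwarz)
      also have "\<dots> \<le> r * ip m m" using ip_u[OF \<open>c \<in> C\<close>] ip_nonneg by (intro mult_right_mono)
      finally show "(ip (u c) m)\<^sup>2 \<le> r * ip m m" .
    qed
    also have "\<dots> = r * Q * ip m m" by (simp add: p_sum flip: sum_distrib_right)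
    finally have "ip m m * ip m m \<le> r * Q * ip m m" by (simp add: power2_eq_square)
    then show ?thesis
      using ip_nonneg[of m] r_pos Q_nonneg
      by (cases "ip m m = 0") (auto simp: mult_le_cancel_right)
  qed
  \<comment> \<open>The square expands with linear term \<open>- 2 * Q / tilt\<close>; as
    \<open>r \<le> tilt\<close>, the quadratic term gives back at most half of that.\<close>
  have \<theta>'_norm: "ip \<theta>' \<theta>' \<le> ip \<theta> \<theta> - Q / tilt"
  proof -
    have "ip \<theta>' \<theta>' = ip \<theta> \<theta> - 2 * Q / tilt + ip m m / tilt\<^sup>2"
      unfolding \<theta>'_def ip_diff_left ip_diff_right ip_scale_left ip_scale_right
      using m\<theta> tilt_pos by (simp add: ip_commute[of \<theta> m] field_simps power2_eq_square)
    moreover have "ip m m / tilt\<^sup>2 \<le> Q / tilt"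
    proof -
      have "ip m m \<le> tilt * Q" using mm r_le_tilt Q_nonneg mult_right_mono order_trans by blast
      then show ?thesis using tilt_pos by (simp add: field_simps power2_eq_square)
    qed
    ultimately show ?thesis by simp
  qed
  \<comment> \<open>After replacing \<open>exp\<close> by the quadratic bound, both first-order sums
    vanish by centring, the cross term is the drift, and the second-order term is at most
    \<open>2 * Q\<close> because the weights are at most 2.\<close>
  have step: "(if good cs then \<Sum>c\<in>C. p c * (1 - ip (u c) (pos cs) / tilt) * exp (ip \<theta> (pos (c # cs))) else 0)
      \<le> exp (2 * Q) * exp (ip \<theta>' (pos cs))" for cs
  proof (cases "good cs")
    case True
    define y where "y c = ip (u c) (pos cs) / tilt" for c
    have "(\<Sum>c\<in>C. p c * (1 - y c) * exp (a c)) \<le> (\<Sum>c\<in>C. p c * (1 - y c) * (1 + a c + (a c)\<^sup>2))"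
      using True unfolding y_def
      by (intro sum_mono mult_left_mono mult_nonneg_nonneg exp_le_quadratic a_bound p_nonneg
          tilt_weight_nonneg) auto
    also have "\<dots> = sum p C - (\<Sum>c\<in>C. p c * y c) + (\<Sum>c\<in>C. p c * a c) - (\<Sum>c\<in>C. p c * a c * y c)
        + (\<Sum>c\<in>C. p c * ((1 - y c) * (a c)\<^sup>2))"
      by (simp add: sum.distrib sum_subtractf algebra_simps)
    also have "(\<Sum>c\<in>C. p c * y c) = 0"
      using ip_u_mean[of "pos cs"] by (simp add: y_def flip: sum_divide_distrib)
    also have "(\<Sum>c\<in>C. p c * a c) = 0" unfolding a_def by (rule ip_u_mean)
    also have "(\<Sum>c\<in>C. p c * a c * y c) = ip m (pos cs) / tilt"
      unfolding ip_m y_def by (simp flip: sum_divide_distrib)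
    also have "(\<Sum>c\<in>C. p c * ((1 - y c) * (a c)\<^sup>2)) \<le> (\<Sum>c\<in>C. p c * (2 * (a c)\<^sup>2))"
      using True unfolding y_def
      by (intro sum_mono mult_left_mono mult_right_mono p_nonneg tilt_weight_nonneg) auto
    also have "(\<Sum>c\<in>C. p c * (2 * (a c)\<^sup>2)) = 2 * Q"
      by (simp add: Q_def sum_distrib_left mult_ac)
    finally have "(\<Sum>c\<in>C. p c * (1 - y c) * exp (a c)) \<le> 1 + (2 * Q - ip m (pos cs) / tilt)"
      by (simp add: p_sum)
    also have "\<dots> \<le> exp (2 * Q - ip m (pos cs) / tilt)" by (rule exp_ge_add_one_self)
    finally have "(\<Sum>c\<in>C. p c * (1 - y c) * exp (a c)) * exp (ip \<theta> (pos cs))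
        \<le> exp (2 * Q - ip m (pos cs) / tilt) * exp (ip \<theta> (pos cs))"
      by (intro mult_right_mono) auto
    also have "\<dots> = exp (2 * Q) * exp (ip \<theta>' (pos cs))"
      unfolding \<theta>'_def ip_diff_left ip_scale_left by (simp flip: exp_add)
    finally show ?thesis
      using True by (simp add: y_def a_def ip_add_right ip_commute[of \<theta> "u _"] exp_add
          sum_distrib_left sum_distrib_right mult_ac)
  qed simp
  have "Ex (Suc n) (\<lambda>cs. exp (ip \<theta> (pos cs))) \<le> Ex n (\<lambda>cs. exp (2 * Q) * exp (ip \<theta>' (pos cs)))"
    unfolding Ex.simps by (rule Ex_mono) (rule step)
  also have "\<dots> = exp (2 * Q) * Ex n (\<lambda>cs. exp (ip \<theta>' (pos cs)))" by (rule Ex_scale)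
  also have "\<dots> \<le> exp (2 * Q) * exp (2 * tilt * ip \<theta>' \<theta>')"
  proof (intro mult_left_mono Suc.IH)
    have "r * ip \<theta>' \<theta>' \<le> r * ip \<theta> \<theta>"
      using \<theta>'_norm Q_nonneg tilt_pos r_pos divide_nonneg_pos[of Q tilt]
      by (intro mult_left_mono) linarith+
    then show "r * ip \<theta>' \<theta>' \<le> 1" using Suc.prems by linarith
  qed simp
  \<comment> \<open>The loss \<open>Q / tilt\<close> of squared length, times
    \<open>2 * tilt\<close>, pays exactly for the factor \<open>exp (2 * Q)\<close>.\<close>
  also have "\<dots> \<le> exp (2 * tilt * ip \<theta> \<theta>)"
  proof -
    have "2 * tilt * ip \<theta>' \<theta>' \<le> 2 * tilt * (ip \<theta> \<theta> - Q / tilt)"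
      using \<theta>'_norm tilt_pos by (intro mult_left_mono) auto
    also have "\<dots> = 2 * tilt * ip \<theta> \<theta> - 2 * Q" using tilt_pos by (simp add: right_diff_distrib)
    finally show ?thesis by (simp flip: exp_add)
  qed
  finally show ?case .
qed

section \<open>Chernoff tail bounds and the union bound over bad events\<close>

lemma Ex_tail:
  assumes "r * (l\<^sup>2 * ip \<phi> \<phi>) \<le> 1" "0 \<le> l"
  shows "Ex n (\<lambda>cs. if ip \<phi> (pos cs) > s then 1 else 0) \<le> exp (2 * tilt * (l\<^sup>2 * ip \<phi> \<phi>) - l * s)"
proof -
  have sq: "ip (\<lambda>i. l * \<phi> i) (\<lambda>i. l * \<phi> i) = l\<^sup>2 * ip \<phi> \<phi>"
    by (simp add: ip_scale_left ip_scale_right power2_eq_square)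
  have "Ex n (\<lambda>cs. if ip \<phi> (pos cs) > s then 1 else 0)
      \<le> Ex n (\<lambda>cs. exp (- (l * s)) * exp (ip (\<lambda>i. l * \<phi> i) (pos cs)))"
  proof (rule Ex_mono)
    fix cs
    have "l * s \<le> l * ip \<phi> (pos cs)" if "s < ip \<phi> (pos cs)"
      using assms(2) that by (intro mult_left_mono) auto
    then show "(if ip \<phi> (pos cs) > s then 1 else 0)
        \<le> exp (- (l * s)) * exp (ip (\<lambda>i. l * \<phi> i) (pos cs))"
      by (auto simp: ip_scale_left simp flip: exp_add)
  qed
  also have "\<dots> = exp (- (l * s)) * Ex n (\<lambda>cs. exp (ip (\<lambda>i. l * \<phi> i) (pos cs)))"
    by (rule Ex_scale)
  also have "\<dots> \<le> exp (- (l * s)) * exp (2 * tilt * (l\<^sup>2 * ip \<phi> \<phi>))"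
    using Ex_exp_le[of "\<lambda>i. l * \<phi> i" n] assms(1) by (intro mult_left_mono) (auto simp: sq)
  also have "\<dots> = exp (2 * tilt * (l\<^sup>2 * ip \<phi> \<phi>) - l * s)" by (simp flip: exp_add)
  finally show ?thesis .
qed

lemma Ex_tail_abs:
  assumes "r * (l\<^sup>2 * ip \<phi> \<phi>) \<le> 1" "0 \<le> l" "2 * tilt * (l\<^sup>2 * ip \<phi> \<phi>) - l * s \<le> - X"
  shows "Ex n (\<lambda>cs. if \<bar>ip \<phi> (pos cs)\<bar> > s then 1 else 0) \<le> 2 * exp (- X)"
proof -
  define \<psi> where "\<psi> i = - 1 * \<phi> i" for i
  have \<psi>: "ip \<psi> f = - ip \<phi> f" "ip f \<psi> = - ip f \<phi>" for f
    unfolding \<psi>_def ip_scale_left ip_scale_right by auto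
  have e: "exp (2 * tilt * (l\<^sup>2 * ip \<phi> \<phi>) - l * s) \<le> exp (- X)" using assms(3) by simp
  have "Ex n (\<lambda>cs. if \<bar>ip \<phi> (pos cs)\<bar> > s then 1 else 0)
      \<le> Ex n (\<lambda>cs. (if ip \<phi> (pos cs) > s then 1 else 0) + (if ip \<psi> (pos cs) > s then 1 else 0))"
    by (rule Ex_mono) (auto simp: \<psi>)
  also have "\<dots> \<le> exp (- X) + exp (- X)"
    unfolding Ex_add 
  proof (rule add_mono)
    show "Ex n (\<lambda>cs. if ip \<phi> (pos cs) > s then 1 else 0) \<le> exp (- X)"
      using Ex_tail[OF assms(1,2)] e by (rule order_trans)
    show "Ex n (\<lambda>cs. if ip \<psi> (pos cs) > s then 1 else 0) \<le> exp (- X)"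
      using Ex_tail[of l \<psi> n s] assms e by (auto simp: \<psi> intro: order_trans)
  qed
  finally show ?thesis by simp
qed

lemma Ex_bad:
  "Ex n (\<lambda>cs. if good cs then 0 else 1) \<le> 2 * (real (card C) + real (card I)) * exp (- X)"
proof -
  let ?e = "\<lambda>i j. if j = i then 1 else 0 :: real"
  have ip_e: "ip (?e i) f = f i" if "i \<in> I" for i f
    using that fin_I by (simp add: ip_def if_distrib[of "\<lambda>x. x * _"] cong: if_cong)
  \<comment> \<open>With \<open>l = 1 / (4 * r)\<close> the quadratic part of the exponent is at
    most \<open>X\<close> and the linear part \<open>l * tilt\<close> is
    \<open>2 * X\<close>.\<close>
  have 1: "Ex n (\<lambda>cs. if \<bar>ip (u c) (pos cs)\<bar> > tilt then 1 else 0) \<le> 2 * exp (- X)" if "c \<in> C" for c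
  proof (rule Ex_tail_abs[where l = "1 / (4 * r)"])
    have le: "(1 / (4 * r))\<^sup>2 * ip (u c) (u c) \<le> (1 / (4 * r))\<^sup>2 * r"
      using ip_u[OF that] by (intro mult_left_mono) auto
    also have "\<dots> = 1 / (16 * r)" using r_pos by (simp add: field_simps power2_eq_square)
    finally have le: "(1 / (4 * r))\<^sup>2 * ip (u c) (u c) \<le> 1 / (16 * r)" .
    show "r * ((1 / (4 * r))\<^sup>2 * ip (u c) (u c)) \<le> 1"
      using mult_left_mono[OF le, of r] r_pos by simp
    have "2 * tilt * ((1 / (4 * r))\<^sup>2 * ip (u c) (u c)) \<le> 2 * tilt * (1 / (16 * r))"
      using le tilt_pos by (intro mult_left_mono) auto
    also have "\<dots> = X" using r_pos by (simp add: tilt_def)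
    finally show "2 * tilt * ((1 / (4 * r))\<^sup>2 * ip (u c) (u c)) - 1 / (4 * r) * tilt \<le> - X"
      using r_pos by (simp add: tilt_def)
  qed (use r_pos in simp)
  \<comment> \<open>A coordinate is the inner product with a unit vector. Since that vector has
    length 1, \<open>l = 1 / (4 * sqrt r)\<close> again gives \<open>X - 2 * X\<close>.\<close>
  have 2: "Ex n (\<lambda>cs. if \<bar>pos cs i\<bar> > 8 * sqrt r * X then 1 else 0) \<le> 2 * exp (- X)" if "i \<in> I" for i
  proof -
    have "Ex n (\<lambda>cs. if \<bar>ip (?e i) (pos cs)\<bar> > 8 * sqrt r * X then 1 else 0) \<le> 2 * exp (- X)"
    proof (rule Ex_tail_abs[where l = "1 / (4 * sqrt r)"])
      have s: "sqrt r * sqrt r = r" using r_pos by simp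
      have l: "(1 / (4 * sqrt r))\<^sup>2 = 1 / (16 * r)"
        using r_pos by (simp add: power_divide power_mult_distrib)
      show "r * ((1 / (4 * sqrt r))\<^sup>2 * ip (?e i) (?e i)) \<le> 1"
        using r_pos by (simp add: l ip_e[OF that])
      show "2 * tilt * ((1 / (4 * sqrt r))\<^sup>2 * ip (?e i) (?e i)) - 1 / (4 * sqrt r) * (8 * sqrt r * X) \<le> - X"
        using r_pos by (simp add: l ip_e[OF that] tilt_def)
    qed (use r_pos in simp)
    then show ?thesis by (simp add: ip_e[OF that])
  qed
  have "Ex n (\<lambda>cs. if good cs then 0 else 1)
      \<le> Ex n (\<lambda>cs. (\<Sum>c\<in>C. if \<bar>ip (u c) (pos cs)\<bar> > tilt then 1 else 0)
              + (\<Sum>i\<in>I. if \<bar>pos cs i\<bar> > 8 * sqrt r * X then 1 else 0))"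
  proof (rule Ex_mono)
    fix cs
    let ?A = "\<lambda>c. if \<bar>ip (u c) (pos cs)\<bar> > tilt then 1 else 0 :: real"
    let ?B = "\<lambda>i. if \<bar>pos cs i\<bar> > 8 * sqrt r * X then 1 else 0 :: real"
    have nn: "0 \<le> sum ?A C" "0 \<le> sum ?B I" by (auto intro!: sum_nonneg)
    have "1 \<le> sum ?A C + sum ?B I" if "\<not> good cs"
    proof -
      from that consider c where "c \<in> C" "?A c = 1" | i where "i \<in> I" "?B i = 1"
        unfolding good_def by force
      then show ?thesis
      proof cases
        case 1
        then have "1 \<le> sum ?A C" using member_le_sum[of c C ?A] fin_C by auto
        then show ?thesis using nn by linarith
      next
        case 2
        then have "1 \<le> sum ?B I" using member_le_sum[of i I ?B] fin_I by auto
        then show ?thesis using nn by linarith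
      qed
    qed
    then show "(if good cs then 0 else 1) \<le> sum ?A C + sum ?B I" using nn by auto
  qed
  also have "\<dots> \<le> (\<Sum>c\<in>C. 2 * exp (- X)) + (\<Sum>i\<in>I. 2 * exp (- X))"
    unfolding Ex_add Ex_sum[OF fin_C] Ex_sum[OF fin_I] by (intro add_mono sum_mono 1 2)
  also have "\<dots> = 2 * (real (card C) + real (card I)) * exp (- X)"
    by (simp add: algebra_simps)
  finally show ?thesis .
qed

text \<open>By centring, the step weights sum to 1 at every position, so mass is lost only through
  killing, and each time loses at most the amount in \<open>Ex_bad\<close>. The walk starts at the
  origin, which is good.\<close>

lemma Ex_good:
  "1 - real n * (2 * (real (card C) + real (card I)) * exp (- X)) \<le> Ex n (\<lambda>cs. if good cs then 1 else 0)"
proof (induction n)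
  case 0
  show ?case using tilt_pos r_pos X_ge by (simp add: good_def ip_def)
next
  case (Suc n)
  have "(\<Sum>c\<in>C. p c * (1 - ip (u c) f / tilt)) = 1" for f
    using ip_u_mean[of f] p_sum by (simp add: algebra_simps sum_subtractf flip: sum_divide_distrib)
  then have "Ex (Suc n) (\<lambda>cs. 1) = Ex n (\<lambda>cs. if good cs then 1 else 0)"
    unfolding Ex.simps mult_1_right by presburger
  moreover have "Ex (Suc n) (\<lambda>cs. 1)
      = Ex (Suc n) (\<lambda>cs. (if good cs then 1 else 0) + (if good cs then 0 else 1))"
    by (intro arg_cong[of _ _ "Ex (Suc n)"] ext) simp
  ultimately show ?case
    using Ex_bad[of "Suc n"] Suc.IH unfolding Ex_add by (simp add: algebra_simps)
qed

section \<open>Extracting a deterministic path\<close>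

lemma pos_rev_map: "pos (rev (map y [0..<t])) i = (\<Sum>s<t. u (y s) i)"
  by (induction t) simp_all

text \<open>A positive sum of terms has a positive term, so a path can be read off step by step.
  Killing tests a state only before a step is taken from it, hence goodness for \<open>t < n\<close>
  alone; the state at time \<open>n\<close> enters through \<open>g\<close>.\<close>

lemma Ex_pos_imp_path:
  "0 < Ex n g \<Longrightarrow> \<exists>y. (\<forall>s<n. y s \<in> C) \<and> (\<forall>t<n. good (rev (map y [0..<t])))
     \<and> 0 < g (rev (map y [0..<n]))"
proof (induction n arbitrary: g)
  case (Suc n)
  obtain y where y: "\<forall>s<n. y s \<in> C" "\<forall>t<n. good (rev (map y [0..<t]))"
    and "0 < (if good (rev (map y [0..<n])) then \<Sum>c\<in>C. p c *
      (1 - ip (u c) (pos (rev (map y [0..<n]))) / tilt) * g (c # rev (map y [0..<n])) else 0)"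
    using Suc.IH[OF Suc.prems[unfolded Ex.simps]] by blast
  then have good: "good (rev (map y [0..<n]))" and "0 < (\<Sum>c\<in>C. p c *
      (1 - ip (u c) (pos (rev (map y [0..<n]))) / tilt) * g (c # rev (map y [0..<n])))"
    by (auto split: if_splits)
  then obtain c where c: "c \<in> C"
    "0 < p c * (1 - ip (u c) (pos (rev (map y [0..<n]))) / tilt) * g (c # rev (map y [0..<n]))"
    using sum_nonpos[of C] by (metis (no_types, lifting) not_le)
  \<comment> \<open>A good state has nonnegative weights, so a positive product forces
    \<open>g\<close> itself to be positive.\<close>
  moreover have "0 \<le> p c * (1 - ip (u c) (pos (rev (map y [0..<n]))) / tilt)"
    using c(1) good by (intro mult_nonneg_nonneg p_nonneg tilt_weight_nonneg)
  ultimately have g: "0 < g (c # rev (map y [0..<n]))"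
    by (auto simp: zero_less_mult_iff)
  have map: "map (y(n := c)) [0..<t] = map y [0..<t]" if "t \<le> n" for t
    using that by simp
  show ?case
    by (rule exI[of _ "y(n := c)"])
      (use y good g c(1) in \<open>auto simp: map less_Suc_eq simp del: fun_upd_apply, auto\<close>)
qed simp

lemma balanced_path:
  assumes "real n * (2 * (real (card C) + real (card I)) * exp (- X)) < 1"
  shows "\<exists>y. (\<forall>s<n. y s \<in> C) \<and> (\<forall>t\<le>n. \<forall>i\<in>I. \<bar>\<Sum>s<t. u (y s) i\<bar> \<le> 8 * sqrt r * X)"
proof -
  \<comment> \<open>Taking the indicator of \<open>good\<close> as \<open>g\<close> supplies the
    missing time \<open>t = n\<close>.\<close>
  have "0 < Ex n (\<lambda>cs. if good cs then 1 else 0)"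
    using Ex_good[of n] assms by linarith
  from Ex_pos_imp_path[OF this] obtain y where y: "\<forall>s<n. y s \<in> C"
    "\<forall>t<n. good (rev (map y [0..<t]))" "good (rev (map y [0..<n]))"
    by (auto split: if_splits)
  then have "good (rev (map y [0..<t]))" if "t \<le> n" for t
    using that by (cases "t = n") auto
  then show ?thesis using y(1) by (auto simp: good_def pos_rev_map intro!: exI[of _ y])
qed

end

section \<open>Dyadic boxes\<close>

text \<open>The pair \<open>(e, b)\<close> encodes the interval of naturals from
  \<open>b * 2 ^ e\<close> up to but excluding \<open>(b + 1) * 2 ^ e\<close>, inside the range
  below \<open>2 ^ K\<close>.\<close>

definition dyadic :: "nat \<Rightarrow> (nat \<times> nat) set" where
  "dyadic K = (SIGMA e:{..K}. {..<2 ^ (K - e)})"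

definition in_dyadic :: "nat \<Rightarrow> nat \<times> nat \<Rightarrow> bool" where
  "in_dyadic x j \<longleftrightarrow> x div 2 ^ fst j = snd j"

lemma finite_dyadic: "finite (dyadic K)"
  by (simp add: dyadic_def)

lemma card_dyadic: "card (dyadic K) \<le> 2 ^ (K + 1)"
proof -
  have "card (dyadic K) = (\<Sum>e\<le>K. 2 ^ (K - e))" by (simp add: dyadic_def)
  also have "\<dots> = (\<Sum>e\<le>K. 2 ^ e)"
    using sum.nat_diff_reindex[of "\<lambda>e. 2 ^ e :: nat" "Suc K"] by (simp add: lessThan_Suc_atMost)
  also have "\<dots> \<le> 2 ^ (K + 1)"
    by (induction K) simp_all
  finally show ?thesis .
qed

text \<open>On each of the \<open>K + 1\<close> levels the intervals partition the range, so each
  level contributes exactly 1.\<close>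

lemma sum_in_dyadic:
  assumes "x < 2 ^ K"
  shows "(\<Sum>j\<in>dyadic K. of_bool (in_dyadic x j)) = (real K + 1)"
proof -
  have "x div 2 ^ e < 2 ^ (K - e)" if "e \<le> K" for e
    using assms that by (intro less_mult_imp_div_less) (simp flip: power_add)
  then have inner: "(\<Sum>b<2 ^ (K - e). if x div 2 ^ e = b then 1 else 0) = (1::real)" if "e \<le> K" for e
    using that by (subst sum.delta') auto
  have "(\<Sum>j\<in>dyadic K. of_bool (in_dyadic x j))
      = (\<Sum>e\<le>K. \<Sum>b<2 ^ (K - e). if x div 2 ^ e = b then 1 else (0::real))"
    unfolding dyadic_def by (subst sum.Sigma) (auto intro!: sum.cong simp: in_dyadic_def simp del: sum_of_bool_eq)
  also have "\<dots> = (\<Sum>e\<le>K. 1)" by (intro sum.cong refl inner) simp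
  finally show ?thesis by simp
qed

text \<open>Binary expansion of \<open>h\<close>: decompose the prefix of length
  \<open>h div 2\<close>, double all its intervals, and add the last point \<open>h - 1\<close> when
  \<open>h\<close> is odd. Each level adds at most one interval.\<close>

lemma prefix_dyadic_decomposition:
  "h \<le> 2 ^ K \<Longrightarrow> \<exists>D\<subseteq>dyadic K. card D \<le> K + 1 \<and>
     (\<forall>x<2 ^ K. (\<Sum>j\<in>D. of_bool (in_dyadic x j)) = (of_bool (x < h) :: real))"
proof (induction K arbitrary: h)
  case 0
  show ?case
  proof (cases "h = 0")
    case True
    then show ?thesis by (intro exI[of _ "{}"]) simp
  next
    case False
    then have "h = 1" using 0 by simp
    then show ?thesis
      by (intro exI[of _ "{(0, 0)}"]) (simp add: dyadic_def in_dyadic_def)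
  qed
next
  case (Suc K)
  have "h div 2 \<le> 2 ^ K" using Suc.prems by simp
  from Suc.IH[OF this] obtain D where D: "D \<subseteq> dyadic K" "card D \<le> K + 1"
    "\<And>x. x < 2 ^ K \<Longrightarrow> (\<Sum>j\<in>D. of_bool (in_dyadic x j)) = (of_bool (x < h div 2) :: real)"
    by blast
  \<comment> \<open>Raising the level by one with the same index doubles an interval, because
    \<open>x div 2 ^ Suc e\<close> is \<open>(x div 2) div 2 ^ e\<close>.\<close>
  define f :: "nat \<times> nat \<Rightarrow> nat \<times> nat" where "f = (\<lambda>j. (Suc (fst j), snd j))"
  define D0 where "D0 = (if odd h then {(0, h - 1)} else {} :: (nat \<times> nat) set)"
  have finD: "finite D" using D(1) finite_dyadic finite_subset by blast
  have inj: "inj_on f D" by (auto simp: inj_on_def f_def prod_eq_iff)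
  have "f ` D \<union> D0 \<subseteq> dyadic (Suc K)"
  proof -
    have "h - 1 < 2 ^ Suc K" if "odd h" using Suc.prems that by (cases h) auto
    then show ?thesis using D(1) by (auto simp: f_def D0_def dyadic_def)
  qed
  moreover have "card (f ` D \<union> D0) \<le> Suc K + 1"
  proof -
    have "card (f ` D \<union> D0) \<le> card (f ` D) + card D0" by (rule card_Un_le)
    also have "card (f ` D) \<le> K + 1" using D(2) card_image_le[OF finD, of f] by linarith
    finally show ?thesis by (auto simp: D0_def split: if_splits)
  qed
  moreover have "(\<Sum>j\<in>f ` D \<union> D0. of_bool (in_dyadic x j)) = (of_bool (x < h) :: real)"
    if x: "x < 2 ^ Suc K" for x
  proof -
    have "(\<Sum>j\<in>f ` D \<union> D0. of_bool (in_dyadic x j) :: real)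
        = (\<Sum>j\<in>f ` D. of_bool (in_dyadic x j)) + (\<Sum>j\<in>D0. of_bool (in_dyadic x j))"
      by (rule sum.union_disjoint) (auto simp: finD f_def D0_def)
    also have "(\<Sum>j\<in>f ` D. of_bool (in_dyadic x j) :: real)
        = (\<Sum>j\<in>D. of_bool (in_dyadic (x div 2) j))"
      by (subst sum.reindex[OF inj]) (simp add: f_def in_dyadic_def div_mult2_eq)
    also have "\<dots> = of_bool (x div 2 < h div 2)" using x by (intro D(3)) simp
    also have "(\<Sum>j\<in>D0. of_bool (in_dyadic x j) :: real) = of_bool (odd h \<and> x = h - 1)"
      by (simp add: D0_def in_dyadic_def)
    also have "of_bool (x div 2 < h div 2) + of_bool (odd h \<and> x = h - 1) = (of_bool (x < h) :: real)"
    proof (cases "odd h")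
      case True
      then obtain q where "h = 2 * q + 1" by (rule oddE)
      then show ?thesis by auto
    next
      case False
      then obtain q where "h = 2 * q" by (auto elim: evenE)
      then show ?thesis by auto
    qed
    finally show ?thesis .
  qed
  ultimately show ?case by blast
qed

lemma of_bool_all: "of_bool (\<forall>s. P s) = (\<Prod>s\<in>UNIV. of_bool (P s) :: real)" for P :: "'d::finite \<Rightarrow> bool"
proof (cases "\<forall>s. P s")
  case False
  then obtain s where "\<not> P s" by blast
  then show ?thesis by (auto intro!: prod_zero[symmetric])
qed simp

text \<open>The walk is run on the indicator vectors of the dyadic boxes; a box at the origin is a
  disjoint union of few of them.\<close>

lemma cell_sequence:
  fixes C :: "('d::finite \<Rightarrow> nat) set" and p :: "('d \<Rightarrow> nat) \<Rightarrow> real" and k :: nat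
  defines "K \<equiv> k + 2"
  defines "L \<equiv> real K + 1" and "d \<equiv> CARD('d)"
  assumes C: "\<And>c s. c \<in> C \<Longrightarrow> c s < 2 ^ K"
    and p_nonneg: "\<And>c. c \<in> C \<Longrightarrow> 0 \<le> p c" and p_sum: "sum p C = 1"
  shows "\<exists>y :: nat \<Rightarrow> 'd \<Rightarrow> nat. (\<forall>j<2 ^ k. y j \<in> C) \<and> (\<forall>t\<le>2 ^ k. \<forall>h. (\<forall>s. h s \<le> 2 ^ K) \<longrightarrow>
     \<bar>\<Sum>j<t. of_bool (\<forall>s. y j s < h s) - (\<Sum>c\<in>C. p c * of_bool (\<forall>s. c s < h s))\<bar>
       \<le> L ^ d * (8 * sqrt (2 * L ^ d) * (L * (real d + 1))))"
proof -
  define I :: "('d \<Rightarrow> nat \<times> nat) set" where "I = PiE UNIV (\<lambda>_. dyadic K)"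
  define v :: "('d \<Rightarrow> nat) \<Rightarrow> ('d \<Rightarrow> nat \<times> nat) \<Rightarrow> real"
    where "v c i = of_bool (\<forall>s. in_dyadic (c s) (i s))" for c i
  define m where "m i = (\<Sum>c\<in>C. p c * v c i)" for i
  \<comment> \<open>Chosen so that \<open>exp X\<close> exceeds
    \<open>2 ^ ((K + 1) * (d + 1))\<close>, which dominates the number of bad events over all
    times.\<close>
  define X where "X = L * (real d + 1)"
  have L_ge: "1 \<le> L" by (simp add: L_def)
  have sub: "C \<subseteq> PiE UNIV (\<lambda>_. {..<2 ^ K})" using C by auto
  have fin_C: "finite C" by (rule finite_subset[OF sub]) (auto intro!: finite_PiE)
  have fin_I: "finite I" unfolding I_def by (intro finite_PiE finite_dyadic) simp
  have v_sum: "(\<Sum>i\<in>I. v c i) = L ^ d" if "c \<in> C" for c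
  proof -
    have "(\<Sum>i\<in>I. v c i) = (\<Prod>s\<in>UNIV. \<Sum>j\<in>dyadic K. of_bool (in_dyadic (c s) j))"
      unfolding v_def I_def of_bool_all
      by (subst prod_sum_PiE) (auto simp: finite_dyadic)
    also have "\<dots> = L ^ d" using that by (simp add: sum_in_dyadic C L_def d_def)
    finally show ?thesis .
  qed
  have m_sum: "(\<Sum>i\<in>I. m i) = L ^ d"
  proof -
    have "(\<Sum>i\<in>I. m i) = (\<Sum>c\<in>C. p c * (\<Sum>i\<in>I. v c i))"
      unfolding m_def by (subst sum.swap) (simp add: sum_distrib_left)
    also have "\<dots> = L ^ d" using p_sum by (simp add: v_sum flip: sum_distrib_right)
    finally show ?thesis .
  qed
  have m01: "0 \<le> m i" "m i \<le> 1" for i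
  proof -
    show "0 \<le> m i" unfolding m_def by (intro sum_nonneg) (simp add: p_nonneg v_def)
    have "m i \<le> (\<Sum>c\<in>C. p c)" unfolding m_def by (intro sum_mono) (simp add: p_nonneg v_def)
    then show "m i \<le> 1" by (simp add: p_sum)
  qed
  interpret tilted_walk C p I "\<lambda>c i. v c i - m i" "2 * L ^ d" X
  proof
    show "(\<Sum>c\<in>C. p c * (v c i - m i)) = 0" for i
      using p_sum by (simp add: right_diff_distrib sum_subtractf m_def flip: sum_distrib_right)
    show "(\<Sum>i\<in>I. (v c i - m i)\<^sup>2) \<le> 2 * L ^ d" if "c \<in> C" for c
    proof -
      \<comment> \<open>\<open>v\<close> takes only the values 0 and 1, and \<open>m\<close> lies
        between 0 and 1. Both have coordinate sum \<open>L ^ d\<close>, which is where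
        \<open>r = 2 * L ^ d\<close> comes from.\<close>
      have "(v c i - m i)\<^sup>2 \<le> v c i + m i" for i
      proof (cases "v c i = 0")
        case True
        then show ?thesis using m01[of i] by (simp add: power2_eq_square mult_left_le)
      next
        case False
        then have "v c i = 1" by (simp add: v_def split: if_splits)
        moreover have "(1 - m i)\<^sup>2 \<le> 1" using m01[of i] by (simp add: power_le_one)
        ultimately show ?thesis using m01[of i] by simp
      qed
      then have "(\<Sum>i\<in>I. (v c i - m i)\<^sup>2) \<le> (\<Sum>i\<in>I. v c i + m i)" by (intro sum_mono)
      also have "\<dots> = 2 * L ^ d" using that by (simp add: sum.distrib v_sum m_sum)
      finally show ?thesis .
    qed
    show "1 \<le> X" unfolding X_def using mult_mono[of 1 L 1 "real d + 1"] L_ge by simp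
  qed (use fin_C fin_I p_nonneg p_sum L_ge in auto)
  have "real (2 ^ k) * (2 * (real (card C) + real (card I)) * exp (- X)) < 1"
  proof -
    have "card C \<le> card (PiE (UNIV :: 'd set) (\<lambda>_. {..<2 ^ K :: nat}))"
      by (intro card_mono finite_PiE sub) auto
    also have "\<dots> = (2 ^ K) ^ d" by (simp add: card_PiE d_def)
    also have "\<dots> \<le> (2 ^ (K + 1)) ^ d" by (intro power_mono) auto
    finally have "card C \<le> (2 ^ (K + 1)) ^ d" .
    moreover have "card I \<le> (2 ^ (K + 1)) ^ d"
    proof -
      have "card I = card (dyadic K) ^ d" by (simp add: I_def d_def card_PiE)
      also have "\<dots> \<le> (2 ^ (K + 1)) ^ d" by (intro power_mono card_dyadic) simp
      finally show ?thesis .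
    qed
    ultimately have "real (card C + card I) \<le> real (2 * (2 ^ (K + 1)) ^ d)"
      by (intro of_nat_mono) linarith
    then have "real (card C) + real (card I) \<le> 2 * 2 ^ ((K + 1) * d)"
      by (simp only: of_nat_add of_nat_mult of_nat_power of_nat_numeral power_mult)
    then have "real (2 ^ k) * (2 * (real (card C) + real (card I)))
        \<le> real (2 ^ k) * (2 * (2 * 2 ^ ((K + 1) * d)))"
      by (intro mult_left_mono) auto
    \<comment> \<open>The two factors 2 turn \<open>2 ^ k\<close> into \<open>2 ^ K\<close>.\<close>
    also have "\<dots> = 2 ^ (K + (K + 1) * d)" by (simp add: K_def power_add)
    also have "\<dots> < 2 ^ ((K + 1) * (d + 1))" by (intro power_strict_increasing) auto
    also have "\<dots> \<le> exp 1 ^ ((K + 1) * (d + 1))"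
      using exp_ge_add_one_self[of 1] by (intro power_mono) auto
    also have "\<dots> = exp X"
      unfolding exp_of_nat_mult[symmetric] by (simp add: X_def L_def algebra_simps)
    finally show ?thesis by (simp add: exp_minus field_simps)
  qed
  from balanced_path[OF this] obtain y :: "nat \<Rightarrow> 'd \<Rightarrow> nat" where "(\<forall>j<2 ^ k. y j \<in> C) \<and>
      (\<forall>t\<le>2 ^ k. \<forall>i\<in>I. \<bar>\<Sum>j<t. v (y j) i - m i\<bar> \<le> 8 * sqrt (2 * L ^ d) * X)"
    by (elim exE)
  then have y: "\<And>j. j < 2 ^ k \<Longrightarrow> y j \<in> C"
    "\<And>t i. t \<le> 2 ^ k \<Longrightarrow> i \<in> I \<Longrightarrow> \<bar>\<Sum>j<t. v (y j) i - m i\<bar> \<le> 8 * sqrt (2 * L ^ d) * X"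
    by simp_all
  have "\<bar>\<Sum>j<t. of_bool (\<forall>s. y j s < h s) - (\<Sum>c\<in>C. p c * of_bool (\<forall>s. c s < h s))\<bar>
      \<le> L ^ d * (8 * sqrt (2 * L ^ d) * X)"
    if t: "t \<le> 2 ^ k" and h: "\<forall>s. h s \<le> 2 ^ K" for t h
  proof -
    have "\<forall>s. \<exists>D\<subseteq>dyadic K. card D \<le> K + 1 \<and>
        (\<forall>x<2 ^ K. (\<Sum>j\<in>D. of_bool (in_dyadic x j)) = (of_bool (x < h s) :: real))"
      using h prefix_dyadic_decomposition by blast
    then obtain D where D: "\<And>s. D s \<subseteq> dyadic K" "\<And>s. card (D s) \<le> K + 1"
      "\<And>s x. x < 2 ^ K \<Longrightarrow> (\<Sum>j\<in>D s. of_bool (in_dyadic x j)) = (of_bool (x < h s) :: real)"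
      by metis
    have fin_D: "finite (D s)" for s using D(1) finite_dyadic finite_subset by blast
    \<comment> \<open>The products of the coordinatewise decompositions tile the box by at most
      \<open>L ^ d\<close> dyadic boxes, whose discrepancies add up.\<close>
    define J where "J = PiE UNIV D"
    have J: "J \<subseteq> I" unfolding J_def I_def using D(1) by (intro PiE_mono) auto
    have box: "of_bool (\<forall>s. c s < h s) = (\<Sum>i\<in>J. v c i)" if "c \<in> C" for c
      unfolding v_def J_def of_bool_all
      by (subst prod_sum_PiE[symmetric]) (auto simp: fin_D D(3) C that simp del: sum_of_bool_eq)
    have "real (card J) \<le> L ^ d"
    proof -
      have "real (card J) = (\<Prod>s\<in>UNIV. real (card (D s)))" by (simp add: J_def card_PiE)
      also have "\<dots> \<le> (\<Prod>s\<in>(UNIV :: 'd set). L)"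
        using of_nat_mono[OF D(2), where ?'a = real] by (intro prod_mono) (auto simp: L_def add.commute)
      finally show ?thesis by (simp add: d_def)
    qed
    have "(\<Sum>c\<in>C. p c * of_bool (\<forall>s. c s < h s)) = (\<Sum>i\<in>J. m i)"
      unfolding m_def by (subst sum.swap) (simp add: box sum_distrib_left)
    then have "(\<Sum>j<t. of_bool (\<forall>s. y j s < h s) - (\<Sum>c\<in>C. p c * of_bool (\<forall>s. c s < h s)))
        = (\<Sum>j<t. \<Sum>i\<in>J. v (y j) i - m i)"
      using y(1) t by (intro sum.cong refl) (simp add: box sum_subtractf)
    also have "\<dots> = (\<Sum>i\<in>J. \<Sum>j<t. v (y j) i - m i)" by (rule sum.swap)
    finally have eq: "(\<Sum>j<t. of_bool (\<forall>s. y j s < h s) - (\<Sum>c\<in>C. p c * of_bool (\<forall>s. c s < h s)))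
        = (\<Sum>i\<in>J. \<Sum>j<t. v (y j) i - m i)" .
    have "\<bar>\<Sum>j<t. of_bool (\<forall>s. y j s < h s) - (\<Sum>c\<in>C. p c * of_bool (\<forall>s. c s < h s))\<bar>
        \<le> (\<Sum>i\<in>J. \<bar>\<Sum>j<t. v (y j) i - m i\<bar>)" 
      unfolding eq by (rule sum_abs)
    also have "\<dots> \<le> (\<Sum>i\<in>J. 8 * sqrt (2 * L ^ d) * X)" using J t by (intro sum_mono y(2)) auto
    also have "\<dots> \<le> L ^ d * (8 * sqrt (2 * L ^ d) * X)"
      using \<open>real (card J) \<le> L ^ d\<close> L_ge X_ge by (simp add: mult_right_mono)
    finally show ?thesis .
  qed
  then show ?thesis unfolding X_def using y(1) by blast
qed

section \<open>Quantile cells\<close>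

text \<open>Adding the two floors gives every atom of mass at least \<open>1 / n\<close> an index of its own.\<close>

definition quantile_index :: "real measure \<Rightarrow> nat \<Rightarrow> real \<Rightarrow> nat" where
  "quantile_index M n t = nat \<lfloor>real n * cdf M t\<rfloor> + nat \<lfloor>real n * measure M {..<t}\<rfloor>"

context real_distribution
begin

section \<open>Distribution functions, half-lines and fibres of the quantile index\<close>

lemma lcdf_mono: "x \<le> y \<Longrightarrow> measure M {..<x} \<le> measure M {..<y}"
  by (rule finite_measure_mono) auto

lemma lcdf_le_cdf: "measure M {..<x} \<le> cdf M x"
  unfolding cdf_def by (rule finite_measure_mono) auto

lemma cdf_le_lcdf: "x < y \<Longrightarrow> cdf M x \<le> measure M {..<y}"
  unfolding cdf_def by (rule finite_measure_mono) auto

lemma borel_measurable_cdf [measurable]: "cdf M \<in> borel_measurable borel"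
  by (rule borel_measurable_mono) (simp add: mono_def cdf_nondecreasing)

lemma borel_measurable_lcdf [measurable]: "(\<lambda>t. measure M {..<t}) \<in> borel_measurable borel"
  by (rule borel_measurable_mono) (simp add: mono_def lcdf_mono)

text \<open>The set is downward closed. If it is a closed half-line its mass is a value of the cdf
  below \<open>c\<close>, if open a left limit of such values; if unbounded above, the limit of the
  cdf forces \<open>1 \<le> c\<close>.\<close>

lemma measure_cdf_less:
  assumes "0 \<le> c"
  shows "measure M {t. cdf M t < c} \<le> c"
proof -
  define A where "A = {t. cdf M t < c}"
  consider "A = {}" | "A \<noteq> {}" "bdd_above A" | "\<not> bdd_above A" by metis
  then have "measure M A \<le> c"
  proof cases
    case 1
    then show ?thesis using assms by simp
  next
    case 2
    define \<sigma> where "\<sigma> = Sup A"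
    have down: "t \<in> A" if t: "t < \<sigma>" for t
    proof -
      obtain t' where "t' \<in> A" "t < t'" using t 2 less_cSup_iff[of A t] by (auto simp: \<sigma>_def)
      then show ?thesis using cdf_nondecreasing[of t t'] by (simp add: A_def)
    qed
    have up: "t \<le> \<sigma>" if "t \<in> A" for t using that 2 by (auto simp: \<sigma>_def intro: cSup_upper)
    show ?thesis
    proof (cases "\<sigma> \<in> A")
      case True
      then have "A = {..\<sigma>}" using down up by (force simp: le_less)
      then have "measure M A = cdf M \<sigma>" by (simp add: cdf_def)
      then show ?thesis using True by (simp add: A_def)
    next
      case False
      then have A: "A = {..<\<sigma>}" using down up by (force simp: le_less)
      have "measure M {..<\<sigma>} \<le> c"
      proof (rule tendsto_upperbound[OF cdf_at_left])
        show "\<forall>\<^sub>F t in at_left \<sigma>. cdf M t \<le> c"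
          using down by (auto simp: A_def eventually_at_filter less_imp_le)
      qed simp
      then show ?thesis by (simp add: A)
    qed
  next
    case 3
    have "cdf M t \<le> c" for t
    proof -
      obtain t' where "t' \<in> A" "t < t'" using 3 by (meson bdd_above.I not_le)
      then show ?thesis using cdf_nondecreasing[of t t'] by (simp add: A_def)
    qed
    then have "1 \<le> c"
      using tendsto_upperbound[OF cdf_lim_at_top_prob, of c] by simp
    then show ?thesis using prob_le_1 order_trans by blast
  qed
  then show ?thesis by (simp only: A_def)
qed

text \<open>Mirror image of \<open>measure_cdf_less\<close> for an upward closed set, by passing to
  complements; the open half-line uses right continuity of the cdf.\<close>

lemma measure_lcdf_ge:
  assumes "b \<le> 1"
  shows "measure M {t. b \<le> measure M {..<t}} \<le> 1 - b"
proof -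
  define B where "B = {t. b \<le> measure M {..<t}}"
  consider "B = {}" | "B \<noteq> {}" "bdd_below B" | "\<not> bdd_below B" by metis
  then have "measure M B \<le> 1 - b"
  proof cases
    case 1
    then show ?thesis using assms by simp
  next
    case 2
    define \<sigma> where "\<sigma> = Inf B"
    have up: "t \<in> B" if t: "\<sigma> < t" for t
    proof -
      obtain t' where "t' \<in> B" "t' < t" using t 2 cInf_less_iff[of B t] by (auto simp: \<sigma>_def)
      then show ?thesis using lcdf_mono[of t' t] by (simp add: B_def)
    qed
    have down: "\<sigma> \<le> t" if "t \<in> B" for t using that 2 by (auto simp: \<sigma>_def intro: cInf_lower)
    show ?thesis
    proof (cases "\<sigma> \<in> B")
      case True
      then have "t \<in> B \<longleftrightarrow> \<sigma> \<le> t" for t using down[of t] up[of t] by (cases "t = \<sigma>") auto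
      then have B: "B = space M - {..<\<sigma>}" by (simp add: set_eq_iff not_le not_less)
      have "measure M B = 1 - measure M {..<\<sigma>}" unfolding B by (subst prob_compl) auto
      then show ?thesis using True by (simp add: B_def)
    next
      case False
      then have "t \<in> B \<longleftrightarrow> \<sigma> < t" for t using down[of t] up[of t] by (cases "t = \<sigma>") auto
      then have B: "B = space M - {..\<sigma>}" by (simp add: set_eq_iff not_le not_less)
      have "b \<le> cdf M \<sigma>"
      proof (rule tendsto_lowerbound)
        show "(cdf M \<longlongrightarrow> cdf M \<sigma>) (at_right \<sigma>)"
          using cdf_is_right_cont[of \<sigma>] by (simp add: continuous_within)
        show "\<forall>\<^sub>F t in at_right \<sigma>. b \<le> cdf M t"
        proof -
          have "b \<le> cdf M t" if "\<sigma> < t" for t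
            using up[OF that] lcdf_le_cdf[of t] by (simp add: B_def)
          then show ?thesis by (simp add: eventually_at_filter)
        qed
      qed simp
      then show ?thesis unfolding B by (subst prob_compl) (auto simp: cdf_def)
    qed
  next
    case 3
    have "b \<le> cdf M t" for t
    proof -
      obtain t' where "t' \<in> B" "t' < t" using 3 by (meson bdd_below.I not_le)
      then show ?thesis using cdf_le_lcdf[of t' t] lcdf_le_cdf[of t'] lcdf_le_cdf[of t] by (simp add: B_def)
    qed
    then have "b \<le> 0"
      using tendsto_lowerbound[OF cdf_lim_at_bot, of b] by simp
    then show ?thesis using prob_le_1[of B] by linarith
  qed
  then show ?thesis by (simp only: B_def)
qed

lemma quantile_index_mono: "x \<le> y \<Longrightarrow> quantile_index M n x \<le> quantile_index M n y"
  unfolding quantile_index_def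
  by (intro add_mono nat_mono floor_mono mult_left_mono cdf_nondecreasing lcdf_mono) auto

lemma quantile_index_le: "quantile_index M n t \<le> 2 * n"
proof -
  have "real n * cdf M t \<le> real n * 1" "real n * measure M {..<t} \<le> real n * 1"
    by (intro mult_left_mono; simp add: cdf_bounded_prob)+
  then have "nat \<lfloor>real n * cdf M t\<rfloor> \<le> n" "nat \<lfloor>real n * measure M {..<t}\<rfloor> \<le> n"
    by (simp_all add: nat_le_iff floor_le_iff)
  then show ?thesis by (simp add: quantile_index_def)
qed

lemma measurable_quantile_index [measurable]:
  "quantile_index M n \<in> measurable borel (count_space UNIV)"
  unfolding quantile_index_def by measurable

text \<open>If a fibre has two points, both floors share one value \<open>j\<close> on it, so it
  lies in the intersection of a lower set of mass at most \<open>(j + 1) / n\<close> and an upper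
  set of mass at most \<open>1 - j / n\<close>. These cover the line, and inclusion-exclusion leaves
  \<open>1 / n\<close>.\<close>

lemma quantile_index_fibre:
  assumes "0 < n" "quantile_index M n t1 = quantile_index M n t2" "t1 < t2"
  shows "measure M {t. quantile_index M n t = quantile_index M n t1} \<le> 1 / real n"
proof -
  define f where "f t = nat \<lfloor>real n * cdf M t\<rfloor>" for t
  define g where "g t = nat \<lfloor>real n * measure M {..<t}\<rfloor>" for t
  have idx: "quantile_index M n t = f t + g t" for t
    by (simp add: quantile_index_def f_def g_def)
  have mono: "f x \<le> f y" "g x \<le> g y" if "x \<le> y" for x y
    using that unfolding f_def g_def
    by (auto intro!: nat_mono floor_mono mult_left_mono cdf_nondecreasing lcdf_mono)
  \<comment> \<open>Both summands are monotone in \<open>t\<close>, so equal sums force equal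
    summands.\<close>
  have eq: "f t = f t' \<and> g t = g t'" if "quantile_index M n t = quantile_index M n t'" for t t'
    using that mono[of t t'] mono[of t' t] linear[of t t'] unfolding idx by linarith
  have "g t1 \<le> f t1"
    unfolding f_def g_def by (intro nat_mono floor_mono mult_left_mono lcdf_le_cdf) auto
  moreover have "f t1 \<le> g t2"
    using assms(3) unfolding f_def g_def
    by (intro nat_mono floor_mono mult_left_mono cdf_le_lcdf) auto
  \<comment> \<open>Sandwich: \<open>g t1 \<le> f t1 \<le> g t2\<close>, and the outer terms
    agree.\<close>
  ultimately have fg: "f t1 = g t1" using eq[OF assms(2)] by simp
  define j where "j = f t1"
  define A where "A = {t. cdf M t < (real j + 1) / n}"
  define B where "B = {t. real j / n \<le> measure M {..<t}}"
  have AB: "t \<in> A \<inter> B" if "quantile_index M n t = quantile_index M n t1" for t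
  proof -
    have "f t = j" "g t = j" using eq[OF that] fg by (auto simp: j_def)
    moreover have "0 \<le> real n * cdf M t" "0 \<le> real n * measure M {..<t}"
      by (simp_all add: cdf_nonneg)
    moreover have "real (nat \<lfloor>x\<rfloor>) \<le> x" "x < real (nat \<lfloor>x\<rfloor>) + 1" if "0 \<le> x" for x :: real
      using that by linarith+
    ultimately have "real n * cdf M t < real j + 1" "real j \<le> real n * measure M {..<t}"
      unfolding f_def g_def by metis+
    then show ?thesis using assms(1) by (simp add: A_def B_def field_simps)
  qed
  have t1: "t1 \<in> A" "t1 \<in> B" using AB[of t1] by auto
  have sets [measurable]: "A \<in> sets borel" "B \<in> sets borel"
    unfolding A_def B_def by measurable
  have "A \<union> B = space M"
  proof -
    have "t \<in> A \<union> B" for t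
    proof (cases "t \<le> t1")
      case True
      then show ?thesis using t1(1) cdf_nondecreasing[of t t1] by (simp add: A_def)
    next
      case False
      then show ?thesis using t1(2) lcdf_mono[of t1 t] by (simp add: B_def)
    qed
    then show ?thesis by auto
  qed
  then have "measure M A + measure M B = 1 + measure M (A \<inter> B)"
    using measure_Un3[of A M B] prob_space by (simp add: fmeasurable_eq_sets)
  moreover have "measure M A \<le> (real j + 1) / n" unfolding A_def by (rule measure_cdf_less) simp
  moreover have "measure M B \<le> 1 - real j / n" unfolding B_def
  proof (rule measure_lcdf_ge)
    have "real j / n \<le> measure M {..<t1}" using t1(2) by (simp add: B_def)
    also have "\<dots> \<le> 1" by simp
    finally show "real j / n \<le> 1" .
  qed
  ultimately have "measure M (A \<inter> B) \<le> 1 / n"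
    by (simp add: add_divide_distrib)
  moreover have "measure M {t. quantile_index M n t = quantile_index M n t1} \<le> measure M (A \<inter> B)"
    using AB by (intro finite_measure_mono) auto
  ultimately show ?thesis by linarith
qed

end

text \<open>Points are picked from the cells given by \<open>cell_sequence\<close>. A box
  \<open>cbox 0 a\<close> is sandwiched between two grid boxes that differ by at most one slab of
  mass \<open>1 / n\<close> per coordinate, and over at most \<open>n\<close> points this costs the
  extra \<open>real d\<close>.\<close>

lemma block_sequence:
  fixes \<mu> :: "(real ^ 'd::finite) measure" and k :: nat
  assumes "prob_space \<mu>" and sets: "sets \<mu> = sets (restrict_space borel unit_cube)"
  defines "L \<equiv> real k + 3" and "d \<equiv> CARD('d)"
  shows "\<exists>y :: nat \<Rightarrow> real ^ 'd. (\<forall>j. y j \<in> unit_cube) \<and> (\<forall>t\<le>2 ^ k. \<forall>a\<in>unit_cube.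
     \<bar>\<Sum>j<t. indicator (cbox 0 a) (y j) - measure \<mu> (cbox 0 a)\<bar>
       \<le> L ^ d * (8 * sqrt (2 * L ^ d) * (L * (real d + 1))) + real d)"
proof -
  interpret prob_space \<mu> by fact
  define n :: nat where "n = 2 ^ k"
  have n_pos: "0 < n" by (simp add: n_def)
  have space: "space \<mu> = unit_cube"
    using sets_eq_imp_space_eq[OF sets] by (simp add: space_restrict_space)
  have coord [measurable]: "(\<lambda>x. x $ s) \<in> borel_measurable \<mu>" for s
    unfolding measurable_cong_sets[OF sets refl]
    by (intro measurable_restrict_space1 borel_measurable_continuous_onI continuous_intros)
  define M where "M s = distr \<mu> borel (\<lambda>x. x $ s)" for s
  have M: "real_distribution (M s)" for s
    unfolding M_def by (rule real_distribution_distr) simp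
  define J :: "real ^ 'd \<Rightarrow> 'd \<Rightarrow> nat" where "J x s = quantile_index (M s) n (x $ s)" for x s
  have J_meas [measurable]: "(\<lambda>x. J x s) \<in> measurable \<mu> (count_space UNIV)" for s
    unfolding J_def using real_distribution.measurable_quantile_index[OF M]
    by (rule measurable_compose[OF coord])
  define C where "C = J ` unit_cube"
  define p where "p c = prob {x \<in> unit_cube. J x = c}" for c
  have J_less: "J x s < 2 ^ (k + 2)" for x s
  proof -
    have "J x s \<le> 2 * n" unfolding J_def by (rule real_distribution.quantile_index_le[OF M])
    also have "\<dots> < 2 ^ (k + 2)" by (simp add: n_def)
    finally show ?thesis .
  qed
  have fin_C: "finite C"
    by (rule finite_subset[of _ "PiE UNIV (\<lambda>_. {..<2 ^ (k + 2)})"])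
      (use J_less in \<open>auto simp: C_def intro!: finite_PiE\<close>)
  have cell_sets: "{x \<in> unit_cube. J x = c} \<in> sets \<mu>" for c
  proof -
    have "{x \<in> space \<mu>. \<forall>s. J x s = c s} \<in> sets \<mu>" by measurable
    then show ?thesis by (simp add: space fun_eq_iff)
  qed
  have p_sum_box: "prob {x \<in> unit_cube. P (J x)} = (\<Sum>c\<in>C. p c * of_bool (P c))" for P
  proof -
    have "{x \<in> unit_cube. P (J x)} = (\<Union>c\<in>{c\<in>C. P c}. {x \<in> unit_cube. J x = c})"
      by (auto simp: C_def)
    also have "prob \<dots> = (\<Sum>c\<in>{c\<in>C. P c}. p c)"
      unfolding p_def using fin_C cell_sets
      by (intro finite_measure_finite_Union) (auto simp: disjoint_family_on_def)
    also have "\<dots> = (\<Sum>c\<in>C. p c * of_bool (P c))"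
      using fin_C by (intro sum.mono_neutral_cong_left) auto
    finally show ?thesis .
  qed
  have "sum p C = 1"
    using p_sum_box[of "\<lambda>_. True"] prob_space by (simp add: space)
  then obtain z :: "nat \<Rightarrow> 'd \<Rightarrow> nat" where z: "\<forall>j<2 ^ k. z j \<in> C"
    "\<forall>t\<le>2 ^ k. \<forall>h. (\<forall>s. h s \<le> 2 ^ (k + 2)) \<longrightarrow>
     \<bar>\<Sum>j<t. of_bool (\<forall>s. z j s < h s) - (\<Sum>c\<in>C. p c * of_bool (\<forall>s. c s < h s))\<bar>
       \<le> L ^ d * (8 * sqrt (2 * L ^ d) * (L * (real d + 1)))"
    using cell_sequence[of C k p] J_less
    by (auto simp: C_def p_def L_def d_def add.commute)
  define D where "D = L ^ d * (8 * sqrt (2 * L ^ d) * (L * (real d + 1)))"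
  \<comment> \<open>The value 0 beyond the block only keeps every \<open>y j\<close> in the
    cube.\<close>
  define y where "y j = (if j < n then SOME x. x \<in> unit_cube \<and> J x = z j else 0)" for j
  have y: "y j \<in> unit_cube \<and> J (y j) = z j" if "j < n" for j
  proof -
    have "\<exists>x. x \<in> unit_cube \<and> J x = z j" using z(1) that unfolding C_def n_def by fastforce
    from someI_ex[OF this] show ?thesis using that by (simp add: y_def)
  qed
  have cube_iff: "x \<in> unit_cube \<longleftrightarrow> (\<forall>s. 0 \<le> x $ s \<and> x $ s \<le> 1)" for x :: "real ^ 'd"
    by (simp add: unit_cube_def mem_box_cart)
  have y_cube: "y j \<in> unit_cube" for j
    using y[of j] by (cases "j < n") (auto simp: y_def cube_iff)
  have "\<bar>\<Sum>j<t. indicator (cbox 0 a) (y j) - prob (cbox 0 a)\<bar> \<le> D + real d"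
    if t: "t \<le> 2 ^ k" and a: "a \<in> unit_cube" for t a
  proof -
    \<comment> \<open>When the fibre of \<open>a $ s\<close> is the single point
      \<open>a $ s\<close>, comparing indices decides \<open>x $ s \<le> a $ s\<close> exactly, so
      the inner box may include that fibre; otherwise it must stop before it.\<close>
    define single where "single s \<longleftrightarrow> (\<forall>r. quantile_index (M s) n r = J a s \<longrightarrow> r = a $ s)" for s
    define h where "h s = J a s + 1" for s
    define l where "l s = J a s + of_bool (single s)" for s
    define Lo where "Lo = {x \<in> unit_cube. \<forall>s. J x s < l s}"
    define Hi where "Hi = {x \<in> unit_cube. \<forall>s. J x s < h s}"
    have lh: "l s \<le> 2 ^ (k + 2)" "h s \<le> 2 ^ (k + 2)" for s
      using J_less[of a s] by (auto simp: l_def h_def)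
    have mem: "x \<in> cbox 0 a \<longleftrightarrow> (\<forall>s. x $ s \<le> a $ s)" if "x \<in> unit_cube" for x
      using that by (auto simp: mem_box_cart cube_iff)
    have sub_cube: "cbox 0 a \<subseteq> unit_cube"
      using a by (auto simp: mem_box_cart cube_iff) (meson order_trans)
    have J_mono: "J x s \<le> J x' s" if "x $ s \<le> x' $ s" for x x' s
      unfolding J_def by (rule real_distribution.quantile_index_mono[OF M that])
    have "Lo \<subseteq> cbox 0 a"
    proof
      fix x assume x: "x \<in> Lo"
      have "x $ s \<le> a $ s" for s
      proof (cases "single s")
        case True
        have "J x s < l s" using x by (auto simp: Lo_def)
        then have "J x s \<le> J a s" using True by (simp add: l_def)
        then consider "J x s = J a s" | "J x s < J a s" by linarith
        then show ?thesis
        proof cases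
          case 1
          then show ?thesis using True by (auto simp: single_def J_def)
        next
          case 2
          then show ?thesis using J_mono[of a s x] by linarith
        qed
      next
        case False
        have "J x s < l s" using x by (auto simp: Lo_def)
        then have "J x s < J a s" using False by (simp add: l_def)
        then show ?thesis using J_mono[of a s x] by linarith
      qed
      then show "x \<in> cbox 0 a" using x mem by (auto simp: Lo_def)
    qed
    have "cbox 0 a \<subseteq> Hi"
      using sub_cube mem J_mono[of _ _ a] by (auto simp: Hi_def h_def less_Suc_eq_le)
    have Lo_Hi_sets: "Lo \<in> sets \<mu>" "Hi \<in> sets \<mu>"
      unfolding Lo_def Hi_def space[symmetric] by measurable
    have box_sets: "cbox 0 a \<in> sets \<mu>"
      unfolding sets using sub_cube
      by (auto simp: sets_restrict_space intro!: image_eqI[of _ _ "cbox 0 a"])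
    \<comment> \<open>The slab is the preimage of a fibre of the marginal \<open>M s\<close>. A
      second point \<open>r\<close> of that fibre may lie on either side of
      \<open>a $ s\<close>.\<close>
    have slab: "prob {x \<in> unit_cube. J x s = J a s} \<le> 1 / real n" if ns: "\<not> single s" for s
    proof -
      interpret Ms: real_distribution "M s" by (rule M)
      obtain r where r: "quantile_index (M s) n r = quantile_index (M s) n (a $ s)" "r \<noteq> a $ s"
        using ns by (auto simp: single_def J_def)
      have "measure (M s) {t. quantile_index (M s) n t = quantile_index (M s) n (a $ s)} \<le> 1 / real n"
        using r Ms.quantile_index_fibre[OF n_pos, of r "a $ s"]
          Ms.quantile_index_fibre[OF n_pos, of "a $ s" r]
        by (cases "r < a $ s") auto
      moreover have "measure (M s) {t. quantile_index (M s) n t = quantile_index (M s) n (a $ s)}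
          = prob {x \<in> unit_cube. J x s = J a s}"
      proof -
        have "{t. quantile_index (M s) n t = quantile_index (M s) n (a $ s)} \<in> sets borel"
          using measurable_sets_borel[OF Ms.measurable_quantile_index, of "{quantile_index (M s) n (a $ s)}" n]
          by (simp add: vimage_def)
        then show ?thesis
          by (subst (1) M_def, subst measure_distr)
            (auto simp: space J_def intro!: arg_cong[of _ _ prob])
      qed
      ultimately show ?thesis by simp
    qed
    have "prob Hi \<le> prob Lo + real d / real n"
    proof -
      let ?S = "\<lambda>s. if single s then {} else {x \<in> unit_cube. J x s = J a s}"
      have S [measurable]: "?S s \<in> sets \<mu>" for s
      proof -
        have "{x \<in> space \<mu>. J x s = J a s} \<in> sets \<mu>" by measurable
        then show ?thesis by (simp add: space)
      qed
      have "Hi \<subseteq> Lo \<union> (\<Union>s. ?S s)"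
      proof
        fix x assume x: "x \<in> Hi"
        show "x \<in> Lo \<union> (\<Union>s. ?S s)"
        proof (cases "x \<in> Lo")
          case False
          then obtain s where s: "\<not> J x s < l s" using x by (auto simp: Lo_def Hi_def)
          have "J x s < h s" using x by (auto simp: Hi_def)
          then have "\<not> single s" "J x s = J a s"
            using s by (auto simp: l_def h_def of_bool_def split: if_splits)
          then have "x \<in> ?S s" using x by (auto simp: Hi_def)
          then show ?thesis by blast
        qed simp
      qed
      then have "prob Hi \<le> prob (Lo \<union> (\<Union>s. ?S s))"
        by (rule finite_measure_mono) (intro sets.Un sets.finite_UN S Lo_Hi_sets; simp)
      also have "\<dots> \<le> prob Lo + prob (\<Union>s. ?S s)"
        by (intro measure_Un_le sets.finite_UN S Lo_Hi_sets) simp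
      also have "prob (\<Union>s. ?S s) \<le> (\<Sum>s\<in>UNIV. prob (?S s))"
        by (intro finite_measure_subadditive_finite image_subsetI S) simp
      also have "\<dots> \<le> (\<Sum>s\<in>(UNIV :: 'd set). 1 / real n)"
        by (intro sum_mono) (auto simp: slab)
      also have "\<dots> = real d / real n" by (simp add: d_def)
      finally show ?thesis by simp
    qed
    then have "real t * (prob Hi - prob Lo) \<le> real t * (real d / real n)"
      by (intro mult_left_mono) auto
    also have "\<dots> \<le> real n * (real d / real n)"
      using t by (intro mult_right_mono) (auto simp: n_def)
    also have "\<dots> = real d" using n_pos by simp
    finally have gap: "real t * (prob Hi - prob Lo) \<le> real d" .
    have mono: "prob Lo \<le> prob (cbox 0 a)" "prob (cbox 0 a) \<le> prob Hi"
      using \<open>Lo \<subseteq> _\<close> \<open>_ \<subseteq> Hi\<close> by (auto intro!: finite_measure_mono Lo_Hi_sets box_sets)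
    have box_bound: "\<bar>(\<Sum>j<t. of_bool (\<forall>s. z j s < g s)) - real t * prob {x \<in> unit_cube. \<forall>s. J x s < g s}\<bar> \<le> D"
      if "\<And>s. g s \<le> 2 ^ (k + 2)" for g
      using z(2) t that unfolding D_def p_sum_box[of "\<lambda>c. \<forall>s. c s < g s"]
      by (simp add: sum_subtractf)
    have "(\<Sum>j<t. of_bool (\<forall>s. z j s < l s)) \<le> (\<Sum>j<t. indicator (cbox 0 a) (y j) :: real)"
    proof (rule sum_mono)
      fix j assume "j \<in> {..<t}"
      then have "j < n" using t by (simp add: n_def)
      then show "of_bool (\<forall>s. z j s < l s) \<le> (indicator (cbox 0 a) (y j) :: real)"
        using y \<open>Lo \<subseteq> _\<close> by (auto simp: Lo_def indicator_def)
    qed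
    moreover have "(\<Sum>j<t. indicator (cbox 0 a) (y j) :: real) \<le> (\<Sum>j<t. of_bool (\<forall>s. z j s < h s))"
    proof (rule sum_mono)
      fix j assume "j \<in> {..<t}"
      then have "j < n" using t by (simp add: n_def)
      then show "(indicator (cbox 0 a) (y j) :: real) \<le> of_bool (\<forall>s. z j s < h s)"
        using y[of j] \<open>_ \<subseteq> Hi\<close> by (force simp: Hi_def indicator_def)
    qed
    moreover have "real t * prob Lo \<le> real t * prob (cbox 0 a)" "real t * prob (cbox 0 a) \<le> real t * prob Hi"
      using mono by (auto intro: mult_left_mono)
    ultimately show ?thesis
      using box_bound[of l, OF lh(1)] box_bound[of h, OF lh(2)] gap
      by (simp add: sum_subtractf right_diff_distrib flip: Lo_def Hi_def)
  qed
  then show ?thesis unfolding D_def using y_cube by blast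
qed

section \<open>Concatenation of blocks\<close>

definition block_bound :: "nat \<Rightarrow> nat \<Rightarrow> real" where
  "block_bound d k = (real k + 3) ^ d * (8 * sqrt (2 * (real k + 3) ^ d) * ((real k + 3) * (real d + 1))) + real d"

lemma block_bound_mono: "i \<le> k \<Longrightarrow> block_bound d i \<le> block_bound d k"
  unfolding block_bound_def
  by (intro add_mono mult_mono power_mono real_sqrt_le_mono order_refl) auto

text \<open>The factor \<open>real k + 1\<close> counts the blocks, and bounding it by
  \<open>M\<close> raises the exponent from \<open>(3 * d + 2) / 2\<close> to
  \<open>(3 * d + 4) / 2\<close>.\<close>

lemma block_bound_total:
  assumes M: "2 * real k + 4 \<le> M"
  shows "(real k + 1) * block_bound d k \<le> 133 * sqrt (real d + 1) * M powr ((3 * real d + 4) / 2)"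
proof -
  define L where "L = real k + 3"
  have L: "1 \<le> L" "0 \<le> L" "4 / 3 * L \<le> M" "0 < M" using M by (auto simp: L_def)
  define Q where "Q = sqrt (L ^ (3 * d + 2))"
  have Q1: "1 \<le> Q" unfolding Q_def real_sqrt_ge_1_iff using L(1) by (rule one_le_power)
  have "L ^ d * (8 * sqrt (2 * L ^ d) * (L * (real d + 1))) = 8 * sqrt 2 * (real d + 1) * Q"
  proof -
    have "L ^ (3 * d + 2) = (L ^ d * L)\<^sup>2 * L ^ d"
      by (simp add: power2_eq_square power_add power_mult power3_eq_cube algebra_simps
          flip: power_mult_distrib)
    then have "Q = L ^ d * L * sqrt (L ^ d)"
      unfolding Q_def using L by (simp add: real_sqrt_mult)
    then show ?thesis by (simp add: real_sqrt_mult)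
  qed
  also have "\<dots> \<le> 12 * (real d + 1) * Q"
  proof -
    have "sqrt 2 \<le> 3 / 2" by (rule real_le_lsqrt) (auto simp: power2_eq_square)
    then show ?thesis using Q1 by (intro mult_right_mono) auto
  qed
  finally have "block_bound d k \<le> 12 * ((real d + 1) * Q) + real d"
    unfolding block_bound_def L_def[symmetric] by (simp only: mult.assoc add_le_cancel_right)
  moreover have "real d \<le> (real d + 1) * Q" using mult_mono[of "real d" "real d + 1" 1 Q] Q1 by simp
  ultimately have B: "block_bound d k \<le> 13 * ((real d + 1) * Q)" by linarith
  \<comment> \<open>The slack in \<open>4 / 3 * L \<le> M\<close> absorbs a factor
    \<open>sqrt (real d + 1)\<close>: the cube of 4/3 exceeds 2, and \<open>2 ^ d\<close> is at
    least \<open>d + 1\<close>.\<close>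
  have "(real d + 1) * L ^ (3 * d + 2) \<le> (4 / 3) ^ (3 * d + 2) * L ^ (3 * d + 2)"
  proof (intro mult_right_mono)
    have "real d + 1 \<le> 2 ^ d" by (induction d) auto
    also have "\<dots> \<le> ((4 / 3) ^ 3) ^ d" by (intro power_mono) (auto simp: power3_eq_cube)
    also have "\<dots> = (4 / 3) ^ (3 * d)" by (simp add: power_mult)
    also have "\<dots> \<le> (4 / 3) ^ (3 * d + 2)" by (intro power_increasing) auto
    finally show "real d + 1 \<le> (4 / 3) ^ (3 * d + 2)" .
  qed (use L in auto)
  also have "\<dots> = (4 / 3 * L) ^ (3 * d + 2)" by (rule power_mult_distrib[symmetric])
  also have "\<dots> \<le> M ^ (3 * d + 2)" using L by (intro power_mono) auto
  finally have "sqrt ((real d + 1) * L ^ (3 * d + 2)) \<le> sqrt (M ^ (3 * d + 2))" by simp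
  then have "sqrt (real d + 1) * sqrt ((real d + 1) * L ^ (3 * d + 2))
      \<le> sqrt (real d + 1) * sqrt (M ^ (3 * d + 2))" by (intro mult_left_mono) auto
  then have "(real d + 1) * Q \<le> sqrt (real d + 1) * sqrt (M ^ (3 * d + 2))"
    unfolding Q_def real_sqrt_mult mult.assoc[symmetric] by simp
  with B have "block_bound d k \<le> 13 * (sqrt (real d + 1) * sqrt (M ^ (3 * d + 2)))" by linarith
  then have "(real k + 1) * block_bound d k \<le> M * (13 * (sqrt (real d + 1) * sqrt (M ^ (3 * d + 2))))"
    using M by (intro mult_mono) (auto simp: block_bound_def)
  also have "\<dots> = 13 * sqrt (real d + 1) * (M * sqrt (M ^ (3 * d + 2)))" by simp
  also have "M * sqrt (M ^ (3 * d + 2)) = M powr ((3 * real d + 4) / 2)"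
  proof -
    have "M * sqrt (M ^ (3 * d + 2)) = M powr 1 * (M powr real (3 * d + 2)) powr (1 / 2)"
      using L(4) powr_realpow[OF L(4), of "3 * d + 2"] powr_half_sqrt[of "M ^ (3 * d + 2)"]
      by (simp only: powr_one zero_le_power less_imp_le)
    also have "\<dots> = M powr (1 + real (3 * d + 2) * (1 / 2))" by (simp only: powr_powr powr_add)
    also have "1 + real (3 * d + 2) * (1 / 2) = (3 * real d + 4) / 2" by simp
    finally show ?thesis .
  qed
  also have "13 * sqrt (real d + 1) * M powr ((3 * real d + 4) / 2)
      \<le> 133 * sqrt (real d + 1) * M powr ((3 * real d + 4) / 2)"
    by (intro mult_right_mono) auto
  finally show ?thesis .
qed

lemma floor_log_power_add: "j < 2 ^ k \<Longrightarrow> floor_log (2 ^ k + j) = k"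
  by (rule floor_log_eqI) auto

theorem theorem2:
  fixes \<mu> :: "(real ^ 'd::finite) measure"
  assumes "prob_space \<mu>"
    and "sets \<mu> = sets (restrict_space borel unit_cube)"
  shows "\<exists>x :: nat \<Rightarrow> real ^ 'd.
           (\<forall>n\<ge>1. x n \<in> unit_cube) \<and>
           (\<forall>N\<ge>1. star_discrepancy \<mu> x N
              \<le> 133 * sqrt (real CARD('d) + 1)
                  * ((4 + 2 * log 2 (real N)) powr ((3 * real CARD('d) + 4) / 2) / real N))"
proof -
  let ?B = "block_bound CARD('d)"
  have "\<forall>k. \<exists>y :: nat \<Rightarrow> real ^ 'd. (\<forall>j. y j \<in> unit_cube) \<and> (\<forall>t\<le>2 ^ k. \<forall>a\<in>unit_cube.
     \<bar>\<Sum>j<t. indicator (cbox 0 a) (y j) - measure \<mu> (cbox 0 a)\<bar> \<le> ?B k)"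
    unfolding block_bound_def by (intro allI block_sequence assms)
  then obtain Y :: "nat \<Rightarrow> nat \<Rightarrow> real ^ 'd" where "\<forall>k. (\<forall>j. Y k j \<in> unit_cube) \<and>
     (\<forall>t\<le>2 ^ k. \<forall>a\<in>unit_cube. \<bar>\<Sum>j<t. indicator (cbox 0 a) (Y k j) - measure \<mu> (cbox 0 a)\<bar> \<le> ?B k)"
    by (rule choice[THEN exE])
  then have Y_cube: "Y k j \<in> unit_cube" and Y: "t \<le> 2 ^ k \<Longrightarrow> a \<in> unit_cube \<Longrightarrow>
      \<bar>\<Sum>j<t. indicator (cbox 0 a) (Y k j) - measure \<mu> (cbox 0 a)\<bar> \<le> ?B k" for k j t a
    by auto
  \<comment> \<open>Block \<open>k\<close> occupies the indices from \<open>2 ^ k\<close> to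
    \<open>2 ^ (k + 1) - 1\<close>, so the blocks partition the indices from 1 on.\<close>
  define x where "x n = Y (floor_log n) (n - 2 ^ floor_log n)" for n
  have disc: "\<bar>(1 / real N) * (\<Sum>n = 1..N. indicator (cbox 0 a) (x n)) - measure \<mu> (cbox 0 a)\<bar>
      \<le> 133 * sqrt (real CARD('d) + 1)
          * ((4 + 2 * log 2 (real N)) powr ((3 * real CARD('d) + 4) / 2) / real N)"
    if N: "1 \<le> N" and a: "a \<in> unit_cube" for N :: nat and a :: "real ^ 'd"
  proof -
    define f :: "nat \<Rightarrow> real" where "f n = indicator (cbox 0 a) (x n) - measure \<mu> (cbox 0 a)" for n
    have block: "\<bar>\<Sum>n=2 ^ k..<2 ^ k + t. f n\<bar> \<le> ?B k" if "t \<le> 2 ^ k" for k t :: nat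
    proof -
      have "(\<Sum>n=2 ^ k..<2 ^ k + t. f n) = (\<Sum>j<t. f (2 ^ k + j))"
        using sum.shift_bounds_nat_ivl[of f 0 "2 ^ k" t] by (simp add: lessThan_atLeast0 add.commute)
      also have "\<dots> = (\<Sum>j<t. indicator (cbox 0 a) (Y k j) - measure \<mu> (cbox 0 a))"
        using that by (intro sum.cong refl) (auto simp: f_def x_def floor_log_power_add)
      finally show ?thesis using Y[OF that a] by simp
    qed
    have blocks: "\<bar>\<Sum>n=1..<2 ^ k. f n\<bar> \<le> (\<Sum>i<k. ?B i)" for k
    proof (induction k)
      case (Suc k)
      have "(\<Sum>n=1..<2 ^ Suc k. f n) = (\<Sum>n=1..<2 ^ k. f n) + (\<Sum>n=2 ^ k..<2 ^ k + 2 ^ k. f n)"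
        by (subst sum.atLeastLessThan_concat) (auto simp: mult_2)
      then show ?case using Suc.IH block[of "2 ^ k" k] by simp
    qed simp
    \<comment> \<open>\<open>k\<close> is the block containing \<open>N\<close>, and
      \<open>t\<close> counts its points up to and including \<open>N\<close>. All earlier blocks
      are complete.\<close>
    define k where "k = floor_log N"
    define t where "t = N + 1 - 2 ^ k"
    have k: "2 ^ k \<le> N" "N < 2 * 2 ^ k"
      using floor_log_exp2_le[of N] floor_log_exp2_gt[of N] N by (auto simp: k_def)
    have "(\<Sum>n=1..N. f n) = (\<Sum>n=1..<2 ^ k. f n) + (\<Sum>n=2 ^ k..<2 ^ k + t. f n)"
      using k by (subst sum.atLeastLessThan_concat) (auto simp: t_def atLeastLessThanSuc_atLeastAtMost)
    then have "\<bar>\<Sum>n=1..N. f n\<bar> \<le> (\<Sum>i<Suc k. ?B i)"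
    proof -
      have "t \<le> 2 ^ k" using k by (simp add: t_def)
      then show ?thesis using blocks[of k] block[of t k] \<open>sum f {1..N} = _\<close> by simp
    qed
    also have "\<dots> \<le> (\<Sum>i<Suc k. ?B k)" by (intro sum_mono block_bound_mono) simp
    also have "\<dots> = (real k + 1) * ?B k" by (simp add: algebra_simps)
    also have "\<dots> \<le> 133 * sqrt (real CARD('d) + 1) * (4 + 2 * log 2 (real N)) powr ((3 * real CARD('d) + 4) / 2)"
    proof (rule block_bound_total)
      have "real (2 ^ k) \<le> real N" using k(1) by (rule of_nat_mono)
      then have "real k \<le> log 2 (real N)" using N by (simp add: le_log_iff powr_realpow)
      then show "2 * real k + 4 \<le> 4 + 2 * log 2 (real N)" by simp
    qed
    finally have "\<bar>\<Sum>n=1..N. f n\<bar> / real N \<le> 133 * sqrt (real CARD('d) + 1)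
          * ((4 + 2 * log 2 (real N)) powr ((3 * real CARD('d) + 4) / 2) / real N)"
      using N by (simp add: divide_right_mono)
    moreover have "(1 / real N) * (\<Sum>n = 1..N. indicator (cbox 0 a) (x n)) - measure \<mu> (cbox 0 a)
        = (\<Sum>n=1..N. f n) / real N"
      using N by (simp add: f_def sum_subtractf field_simps)
    ultimately show ?thesis by simp
  qed
  \<comment> \<open>This makes the index set of the supremum nonempty.\<close>
  have "(0 :: real ^ 'd) \<in> unit_cube" by (simp add: unit_cube_def mem_box_cart)
  then have "star_discrepancy \<mu> x N \<le> 133 * sqrt (real CARD('d) + 1)
        * ((4 + 2 * log 2 (real N)) powr ((3 * real CARD('d) + 4) / 2) / real N)" if "1 \<le> N" for N
    unfolding star_discrepancy_def using disc[OF that] by (intro cSUP_least) auto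
  moreover have "x n \<in> unit_cube" for n by (simp add: x_def Y_cube)
  ultimately show ?thesis by blast
qed

end
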